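(* Let $p,q_1,q_2\in\mathbb{C}$ with $p\ne -1$, let $r_1,r_2$ be odd integers, and let $$s(t)=\frac{p^t+q_1\sin(r_1\pi t)+q_2\cos(r_2\pi t)}{t}.$$ Then in the four-point expression $$a(s)=\frac{s(t)\,t+s(t+1)\,(t+1)}{s(t+2)\,(t+2)+s(t+3)\,(t+3)}$$ the trigonometric terms cancel entirely: the numerator equals $p^t+p^{t+1}$ and the denominator equals $p^{t+2}+p^{t+3}$. The value is therefore determined solely by the exponential component, $$a(s)=\frac{1}{p^2}.$$ Hence the four-point expression is constant for all $t\in\mathbb{R}\setminus\{-3,-2,-1,0\}$, regardless of the presence of the oscillatory terms.
   Context: The function $s$ is a complex-valued function of a real variable $t\neq 0$, and $a(s)$ denotes the value of the displayed four-point ratio. *)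

theory Defs
  imports "HOL-Analysis.Analysis"
begin

text \<open>Since \<open>p\<close> is complex and \<open>t\<close> is real, \<open>p\<^sup>t\<close> is read as the principal power
  \<open>exp (t * Ln p)\<close>, which is what \<open>powr\<close> denotes for \<open>p \<noteq> 0\<close>.
  The library sets \<open>0 powr z = 0\<close> for every \<open>z\<close>.\<close>

definition osc_exp ::
  "complex \<Rightarrow> complex \<Rightarrow> complex \<Rightarrow> int \<Rightarrow> int \<Rightarrow> real \<Rightarrow> complex" where
  "osc_exp p q\<^sub>1 q\<^sub>2 r\<^sub>1 r\<^sub>2 t =
     (p powr of_real t
        + q\<^sub>1 * of_real (sin (of_int r\<^sub>1 * pi * t))
        + q\<^sub>2 * of_real (cos (of_int r\<^sub>2 * pi * t))) / of_real t"

definition four_point_num :: "(real \<Rightarrow> complex) \<Rightarrow> real \<Rightarrow> complex" where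
  "four_point_num s t = s t * of_real t + s (t + 1) * of_real (t + 1)"

definition four_point_den :: "(real \<Rightarrow> complex) \<Rightarrow> real \<Rightarrow> complex" where
  "four_point_den s t = s (t + 2) * of_real (t + 2) + s (t + 3) * of_real (t + 3)"

definition four_point :: "(real \<Rightarrow> complex) \<Rightarrow> real \<Rightarrow> complex" where
  "four_point s t = four_point_num s t / four_point_den s t"

end

theory Submission
  imports Defs
begin

text \<open>For an odd integer \<open>r\<close>, advancing \<open>t\<close> by \<open>1\<close> advances the angle \<open>r * pi * t\<close> by an odd
  multiple of \<open>pi\<close>, so both trigonometric terms change sign (\<open>sin_odd_shift\<close>, \<open>cos_odd_shift\<close>).
  The factor \<open>t\<close> removes the denominator of \<open>s t\<close>, hence adding the values at two neighbouring
  points cancels the oscillation and leaves \<open>p\<^sup>u + p\<^sup>u\<^sup>+\<^sup>1\<close> (\<open>osc_exp_pair\<close>).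
  The numerator is this sum at \<open>u = t\<close> and the denominator is the same sum at \<open>u = t + 2\<close>; the four
  excluded values of \<open>t\<close> are those at which one of the four factors vanishes.
  Since each unit step multiplies the principal power by \<open>p\<close>, the two sums are \<open>p\<^sup>t (1 + p)\<close> and
  \<open>p\<^sup>2 p\<^sup>t (1 + p)\<close>, and the common factor is nonzero when \<open>p\<close> is neither \<open>0\<close> nor \<open>-1\<close>.
  For \<open>p = 0\<close> both sums vanish, and the value formula is the convention \<open>0 / 0 = 0 = 1 / 0\<close>.\<close>

lemma sin_odd_shift:
  fixes r :: int and t :: real
  assumes "odd r"
  shows "sin (of_int r * pi * (t + 1)) = - sin (of_int r * pi * t)"
proof -
  have "of_int r * pi * (t + 1) = of_int r * pi * t + pi * of_int r"
    by (simp add: algebra_simps)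
  then show ?thesis
    using assms by (simp only: sin_add cos_npi_int sin_npi_int) simp
qed

lemma cos_odd_shift:
  fixes r :: int and t :: real
  assumes "odd r"
  shows "cos (of_int r * pi * (t + 1)) = - cos (of_int r * pi * t)"
proof -
  have "of_int r * pi * (t + 1) = of_int r * pi * t + pi * of_int r"
    by (simp add: algebra_simps)
  then show ?thesis
    using assms by (simp only: cos_add cos_npi_int sin_npi_int) simp
qed

lemma osc_exp_pair:
  fixes u :: real
  assumes "odd r\<^sub>1" and "odd r\<^sub>2" and "u \<noteq> 0" and "u + 1 \<noteq> 0"
  shows "osc_exp p q\<^sub>1 q\<^sub>2 r\<^sub>1 r\<^sub>2 u * of_real u
           + osc_exp p q\<^sub>1 q\<^sub>2 r\<^sub>1 r\<^sub>2 (u + 1) * of_real (u + 1)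
         = p powr of_real u + p powr of_real (u + 1)"
proof -
  have clear: "osc_exp p q\<^sub>1 q\<^sub>2 r\<^sub>1 r\<^sub>2 v * of_real v
      = p powr of_real v + q\<^sub>1 * of_real (sin (of_int r\<^sub>1 * pi * v))
        + q\<^sub>2 * of_real (cos (of_int r\<^sub>2 * pi * v))" if "v \<noteq> 0" for v
    using that by (simp add: osc_exp_def)
  show ?thesis
    unfolding clear[OF assms(3)] clear[OF assms(4)]
      sin_odd_shift[OF assms(1)] cos_odd_shift[OF assms(2)]
    by simp
qed

text \<open>The base \<open>0\<close> is covered as well, because \<open>0 powr z = 0\<close> for every \<open>z\<close>.\<close>

lemma powr_of_real_plus_one:
  fixes p :: complex
  shows "p powr of_real (u + 1) = p * p powr of_real u"
  by (cases "p = 0") (simp_all add: powr_add)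

theorem mainTheorem3:
  fixes p q\<^sub>1 q\<^sub>2 :: complex and r\<^sub>1 r\<^sub>2 :: int and s :: "real \<Rightarrow> complex"
  assumes "p \<noteq> -1" and "odd r\<^sub>1" and "odd r\<^sub>2"
    and "\<And>t. t \<noteq> 0 \<Longrightarrow> s t = osc_exp p q\<^sub>1 q\<^sub>2 r\<^sub>1 r\<^sub>2 t"
  shows "(\<forall>t::real. t \<notin> {-3, -2, -1, 0} \<longrightarrow>
            four_point_num s t = p powr of_real t + p powr of_real (t + 1) \<and>
            four_point_den s t = p powr of_real (t + 2) + p powr of_real (t + 3) \<and>
            (p \<noteq> 0 \<longrightarrow> four_point_den s t \<noteq> 0) \<and>
            four_point s t = 1 / p\<^sup>2)
       \<and> four_point s constant_on (UNIV - {-3, -2, -1, 0})"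
proof -
  have at_t: "four_point_num s t = p powr of_real t + p powr of_real (t + 1) \<and>
            four_point_den s t = p powr of_real (t + 2) + p powr of_real (t + 3) \<and>
            (p \<noteq> 0 \<longrightarrow> four_point_den s t \<noteq> 0) \<and>
            four_point s t = 1 / p\<^sup>2" if t: "t \<notin> {-3, -2, -1, 0}" for t :: real
  proof -
    have nz: "t \<noteq> 0" "t + 1 \<noteq> 0" "t + 2 \<noteq> 0" "t + 3 \<noteq> 0"
      using t by auto
    have num: "four_point_num s t = p powr of_real t + p powr of_real (t + 1)"
      unfolding four_point_num_def assms(4)[OF nz(1)] assms(4)[OF nz(2)]
      by (rule osc_exp_pair[OF assms(2,3) nz(1,2)])
    have t3: "(t + 2) + 1 = t + 3"
      by simp
    have den: "four_point_den s t = p powr of_real (t + 2) + p powr of_real (t + 3)"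
      unfolding four_point_den_def assms(4)[OF nz(3)] assms(4)[OF nz(4)]
      by (rule osc_exp_pair[OF assms(2,3) nz(3), unfolded t3, OF nz(4)])
    have t2: "(t + 1) + 1 = t + 2"
      by simp
    have num': "four_point_num s t = p powr of_real t * (1 + p)"
      unfolding num powr_of_real_plus_one by (simp add: algebra_simps)
    have den': "four_point_den s t = p\<^sup>2 * (p powr of_real t * (1 + p))"
      unfolding den t3[symmetric] powr_of_real_plus_one
      unfolding t2[symmetric] powr_of_real_plus_one
      by (simp add: algebra_simps power2_eq_square)
    have "1 + p \<noteq> 0"
      using assms(1) by (simp add: add_eq_0_iff)
    then have "four_point_den s t \<noteq> 0" if "p \<noteq> 0"
      using that by (simp add: den')
    moreover have "four_point s t = 1 / p\<^sup>2"
      using \<open>1 + p \<noteq> 0\<close> by (cases "p = 0") (simp_all add: four_point_def num' den')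
    ultimately show ?thesis
      using num den by blast
  qed
  moreover have "four_point s constant_on (UNIV - {-3, -2, -1, 0})"
    unfolding constant_on_def using at_t by blast
  ultimately show ?thesis
    by blast
qed

end
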